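(* Let $R$ be a non-singular, irreducible, aperiodic, positive recurrent homogeneous random walk in the quarter-plane, with interior transition probabilities $p_{s,t}$ and axis transition probabilities $h_s$, $v_t$. Let the invariant measure of $R$ be $m(i,j)=\sum_{(\rho,\sigma)\in\Gamma}\alpha(\rho,\sigma)\rho^i\sigma^j$, where $\Gamma\subset Q_U^{+}$, $|\Gamma|=\infty$, $\alpha(\rho,\sigma)\in\mathbb{R}\setminus\{0\}$ for all $(\rho,\sigma)\in\Gamma$, $\sum_{(\rho,\sigma)\in\Gamma}|\alpha(\rho,\sigma)|\frac{1}{1-\rho}\frac{1}{1-\sigma}<\infty$, and for any $(\rho,\sigma)\in\Gamma$ there exists $(w,v)\in\mathbb{N}^2$ with $\tilde\rho^{w}\tilde\sigma^{v}\neq\rho^w\sigma^v$ for all $(\tilde\rho,\tilde\sigma)\in\Gamma\setminus\{(\rho,\sigma)\}$. Then at least one $\alpha(\rho,\sigma)$, $(\rho,\sigma)\in\Gamma$, is negative.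
   Context: Notation: $\mathbb{N}_0=\{0,1,2,\dots\}$, $\mathbb{N}=\{1,2,\dots\}$. Random walk. $R$ is a discrete-time Markov chain on $S=\{(i,j): i,j\in\mathbb{N}_0\}$; $p_{s,t}(i,j)$ is the probability of going from $(i,j)$ to $(i+s,j+t)$, and it is zero if $|s|>1$ or $|t|>1$. The interior is $\{i>0,j>0\}$, the horizontal axis is $\{i>0,j=0\}$, the vertical axis is $\{i=0,j>0\}$. The walk is homogeneous: for each two states $(i,j),(k,l)$ both in the interior (respectively both on the horizontal axis, both on the vertical axis), $p_{s,t}(i,j)=p_{s,t}(k,l)$ and $p_{s,t}(i-s,j-t)=p_{s,t}(k-s,l-t)$ for all $s,t\in\{-1,0,1\}$. For $i,j>0$ write $p_{s,t}=p_{s,t}(i,j)$, $h_s=p_{s,0}(i,0)$, $v_t=p_{0,t}(0,j)$. Consequently transitions from the horizontal axis into the row $j=1$ have probabilities $p_{s,1}$, transitions from the vertical axis into the column $i=1$ have probabilities $p_{1,t}$, and from the origin one goes to $(1,0),(0,1),(1,1)$ with probabilities $h_1,v_1,p_{1,1}$. Invariant measure. A positive finite measure $m$ on $S$ is invariant if it satisfies the balance equations, for all $i,j>0$: $m(i,j)=\sum_{s,t=-1}^{1}m(i-s,j-t)p_{s,t}$; $m(i,0)=\sum_{s=-1}^1 m(i-s,1)p_{s,-1}+\sum_{s=-1}^1 m(i-s,0)h_s$; $m(0,j)=\sum_{t=-1}^1 m(1,j-t)p_{-1,t}+\sum_{t=-1}^1 m(0,j-t)v_t$ (balance at the origin is implied).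 Curve. $Q(x,y)=xy\big(\sum_{s=-1}^{1}\sum_{t=-1}^{1}x^{-s}y^{-t}p_{s,t}-1\big)$, a polynomial; $Q$ also denotes $\{(x,y)\in\mathbb{R}^2: Q(x,y)=0\}$; $Q^+=Q\cap[0,\infty)^2$; $U=(0,1)^2$; $Q_U^+=Q^+\cap U$. $R$ is singular if the polynomial $Q(x,y)$ is reducible or of degree $1$ in at least one of the variables. *)

theory Defs
  imports
    "HOL-Probability.Probability"
    "HOL-Computational_Algebra.Computational_Algebra"
begin

section \<open>Discrete-time Markov chains on a countable state space\<close>

text \<open>A chain is given by its transition kernel; \<open>trajectory K n x\<close> is the joint law of
  \<open>[X\<^sub>1, \<dots>, X\<^sub>n]\<close> when \<open>X\<^sub>0 = x\<close>.\<close>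

primrec trajectory :: "('s \<Rightarrow> 's pmf) \<Rightarrow> nat \<Rightarrow> 's \<Rightarrow> 's list pmf" where
  "trajectory K 0 x = return_pmf []"
| "trajectory K (Suc n) x =
     bind_pmf (K x) (\<lambda>y. map_pmf (\<lambda>ys. y # ys) (trajectory K n y))"

definition nstep_prob :: "('s \<Rightarrow> 's pmf) \<Rightarrow> nat \<Rightarrow> 's \<Rightarrow> 's \<Rightarrow> real" where
  "nstep_prob K n x y = measure_pmf.prob (trajectory K n x) {ys. last (x # ys) = y}"

definition irreducible_chain :: "('s \<Rightarrow> 's pmf) \<Rightarrow> bool" where
  "irreducible_chain K \<longleftrightarrow> (\<forall>x y. \<exists>n. nstep_prob K n x y > 0)"

definition aperiodic_chain :: "('s \<Rightarrow> 's pmf) \<Rightarrow> bool" where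
  "aperiodic_chain K \<longleftrightarrow> (\<forall>x. Gcd {n. n > 0 \<and> nstep_prob K n x x > 0} = 1)"

text \<open>\<open>return_prob K x n\<close> is the probability that the first return time to \<open>x\<close> of the chain
  started in \<open>x\<close> is equal to \<open>n\<close>.\<close>

definition return_prob :: "('s \<Rightarrow> 's pmf) \<Rightarrow> 's \<Rightarrow> nat \<Rightarrow> real" where
  "return_prob K x n =
     measure_pmf.prob (trajectory K n x) {ys. ys \<noteq> [] \<and> last ys = x \<and> x \<notin> set (butlast ys)}"

definition positive_recurrent_chain :: "('s \<Rightarrow> 's pmf) \<Rightarrow> bool" where
  "positive_recurrent_chain K \<longleftrightarrow>
     (\<forall>x. return_prob K x sums 1 \<and> summable (\<lambda>n. real n * return_prob K x n))"


section \<open>Homogeneous random walks in the quarter-plane\<close>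

type_synonym walk = "nat \<times> nat \<Rightarrow> (nat \<times> nat) pmf"

text \<open>\<open>jump K s t i j\<close> is $p_{s,t}(i,j)$. Coordinates are integers, so that the shifted indices
  $i-s$, $j-t$ need no truncation; the value is 0 if the source or the target lies outside the
  quarter-plane.\<close>

definition jump :: "walk \<Rightarrow> int \<Rightarrow> int \<Rightarrow> int \<Rightarrow> int \<Rightarrow> real" where
  "jump K s t i j =
     (if 0 \<le> i \<and> 0 \<le> j \<and> 0 \<le> i + s \<and> 0 \<le> j + t
      then pmf (K (nat i, nat j)) (nat (i + s), nat (j + t)) else 0)"

definition interior_states :: "(int \<times> int) set" where
  "interior_states = {(i, j). i > 0 \<and> j > 0}"

definition horizontal_axis :: "(int \<times> int) set" where
  "horizontal_axis = {(i, j). i > 0 \<and> j = 0}"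

definition vertical_axis :: "(int \<times> int) set" where
  "vertical_axis = {(i, j). i = 0 \<and> j > 0}"

definition homogeneous_walk :: "walk \<Rightarrow> bool" where
  "homogeneous_walk K \<longleftrightarrow>
     (\<forall>s t i j. \<bar>s\<bar> > 1 \<or> \<bar>t\<bar> > 1 \<longrightarrow> jump K s t i j = 0) \<and>
     (\<forall>A \<in> {interior_states, horizontal_axis, vertical_axis}.
       \<forall>(i, j) \<in> A. \<forall>(k, l) \<in> A. \<forall>s \<in> {-1, 0, 1}. \<forall>t \<in> {-1, 0, 1}.
         jump K s t i j = jump K s t k l \<and>
         jump K s t (i - s) (j - t) = jump K s t (k - s) (l - t))"

text \<open>The constants $p_{s,t}$, $h_s$ and $v_t$ of a homogeneous walk, read off at the
  representatives $(1,1)$, $(1,0)$ and $(0,1)$.\<close>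

definition p_int :: "walk \<Rightarrow> int \<Rightarrow> int \<Rightarrow> real" where
  "p_int K s t = jump K s t 1 1"

definition p_hor :: "walk \<Rightarrow> int \<Rightarrow> real" where
  "p_hor K s = jump K s 0 1 0"

definition p_ver :: "walk \<Rightarrow> int \<Rightarrow> real" where
  "p_ver K t = jump K 0 t 0 1"


section \<open>Invariant measures\<close>

text \<open>All arguments of \<open>nat\<close> below are nonnegative. A measure is given by its point masses.\<close>

definition invariant_measure :: "walk \<Rightarrow> (nat \<times> nat \<Rightarrow> real) \<Rightarrow> bool" where
  "invariant_measure K m \<longleftrightarrow>
     (\<forall>z. m z \<ge> 0) \<and> (\<exists>z. m z \<noteq> 0) \<and> m summable_on UNIV \<and>
     (\<forall>i>0. \<forall>j>0. m (nat i, nat j) =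
        (\<Sum>s = -1..1. \<Sum>t = -1..1. m (nat (i - s), nat (j - t)) * p_int K s t)) \<and>
     (\<forall>i>0. m (nat i, 0) =
        (\<Sum>s = -1..1. m (nat (i - s), 1) * p_int K s (-1)) +
        (\<Sum>s = -1..1. m (nat (i - s), 0) * p_hor K s)) \<and>
     (\<forall>j>0. m (0, nat j) =
        (\<Sum>t = -1..1. m (1, nat (j - t)) * p_int K (-1) t) +
        (\<Sum>t = -1..1. m (0, nat (j - t)) * p_ver K t))"


section \<open>The kernel polynomial and its curve\<close>

text \<open>An element of $\mathbb{R}[x][y]$: the outer variable is $y$, the coefficients are
  polynomials in $x$.\<close>

definition Q_poly :: "walk \<Rightarrow> real poly poly" where
  "Q_poly K =
     (\<Sum>s = -1..1. \<Sum>t = -1..1. monom (monom (p_int K s t) (nat (1 - s))) (nat (1 - t)))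
     - monom (monom 1 1) 1"

definition eval2 :: "real poly poly \<Rightarrow> real \<Rightarrow> real \<Rightarrow> real" where
  "eval2 P x y = poly (poly P [:y:]) x"

definition degree_y :: "real poly poly \<Rightarrow> nat" where
  "degree_y P = degree P"

definition degree_x :: "real poly poly \<Rightarrow> nat" where
  "degree_x P = Max ((\<lambda>k. degree (coeff P k)) ` {..degree P})"

lemma eval2_Q_poly:
  assumes "x \<noteq> 0" "y \<noteq> 0"
  shows "eval2 (Q_poly K) x y =
    x * y * ((\<Sum>s = -1..1. \<Sum>t = -1..1. x powi (-s) * y powi (-t) * p_int K s t) - 1)"
proof -
  have I: "{-1..1::int} = {-1, 0, 1}" by auto
  show ?thesis
    using assms
    by (simp add: eval2_def Q_poly_def I poly_monom power_int_def nat_add_distrib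
        poly_const_pow field_simps power2_eq_square)
qed

text \<open>Irreducibility is taken in $\mathbb{R}[x,y]$.\<close>

definition singular_walk :: "walk \<Rightarrow> bool" where
  "singular_walk K \<longleftrightarrow>
     \<not> irreducible (Q_poly K) \<or> degree_x (Q_poly K) = 1 \<or> degree_y (Q_poly K) = 1"

definition Q_curve :: "walk \<Rightarrow> (real \<times> real) set" where
  "Q_curve K = {(x, y). eval2 (Q_poly K) x y = 0}"

definition Q_plus :: "walk \<Rightarrow> (real \<times> real) set" where
  "Q_plus K = Q_curve K \<inter> {0..} \<times> {0..}"

definition Q_plus_U :: "walk \<Rightarrow> (real \<times> real) set" where
  "Q_plus_U K = Q_plus K \<inter> {0<..<1} \<times> {0<..<1}"

end

theory Submission
  imports Defs "HOL-Computational_Algebra.Field_as_Ring"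
begin

text \<open>Suppose all coefficients are positive. Summing the balance equation of the horizontal axis
  against $\rho^n$ for all $n$ shows that, on every column of $\Gamma$, the boundary defects weighted
  by $\alpha$ cancel. Since $Q$ is quadratic in each variable, every point of $\Gamma$ with nonzero
  defects therefore has exactly one partner in its column and one in its row, and the defects of
  partners have opposite signs. Points where a defect vanishes are common zeros of $Q$ and another
  curve, hence finite in number.

  In logarithmic coordinates $Q^+$ is the boundary of a convex set and contains the origin, so a point of
  $\Gamma$ cannot have its row partner to the left and its column partner below. Hence partners link
  the points of $\Gamma$ into monotone staircases. An infinite staircase converges. Its limit is not
  inside the positive quadrant, since there the gradient of $Q$ would vanish; it is not on an axis
  away from $(0,0)$; and at $(0,0)$ the alternating signs force $p_{1,1}=h_1=v_1=0$, so that the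
  walk cannot leave the origin. Thus every staircase is finite and ends in one of finitely many
  points, and Koenig's lemma makes $\Gamma$ finite.\<close>

section \<open>Moments and common zeros\<close>

text \<open>Vanishing moments make \<open>c\<close> orthogonal to all polynomials in
  \<open>f\<close>, and suitable ones tend boundedly to the indicator of a level set. With
  \<open>f\<close> a coordinate, the level sets are the columns or rows of \<Gamma>.\<close>

lemma has_sum_fibre_zero_of_moments_zero:
  fixes c f :: "'a \<Rightarrow> real"
  assumes f: "\<And>x. x \<in> A \<Longrightarrow> 0 \<le> f x \<and> f x \<le> 1"
    and mom: "\<And>n. ((\<lambda>x. c x * f x ^ n) has_sum 0) A"
  shows "(c has_sum 0) {x \<in> A. f x = r}"
proof (cases "0 \<le> r \<and> r \<le> 1")
  case False
  then have "{x \<in> A. f x = r} = {}" using f by auto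
  then show ?thesis by (simp only: has_sum_empty)
next
  case True
  have poly: "((\<lambda>x. c x * f x ^ n * poly q (f x)) has_sum 0) A" for n q
  proof (induction q arbitrary: n)
    case 0
    show ?case by simp
  next
    case (pCons a q)
    have "((\<lambda>x. a * (c x * f x ^ n) + c x * f x ^ Suc n * poly q (f x)) has_sum (a * 0 + 0)) A"
      by (intro has_sum_add has_sum_cmult_right mom pCons.IH)
    then show ?case by (simp add: algebra_simps)
  qed
  \<comment> \<open>The powers of \<open>g\<close> are polynomials in \<open>f\<close> and decrease to the indicator of the fibre.\<close>
  define g where "g x = 1 - (f x - r)^2" for x
  define d where "d x = (if f x = r then c x else 0)" for x
  have g: "((\<lambda>x. c x * g x ^ n) has_sum 0) A" for n
    using poly[of 0 "(1 - [:-r, 1:]^2) ^ n"] by (simp add: g_def algebra_simps)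
  have g01: "0 \<le> g x \<and> g x \<le> 1" if "x \<in> A" for x
  proof -
    have "\<bar>f x - r\<bar> \<le> 1" using f[OF that] True by auto
    then have "(f x - r)^2 \<le> 1" by (simp add: abs_square_le_1)
    then show ?thesis by (simp add: g_def)
  qed
  \<comment> \<open>Real summability is absolute, so the moment of order 0 supplies an integrable
    majorant.\<close>
  have c: "integrable (count_space A) c"
  proof -
    have "c summable_on A" using mom[of 0] by (auto simp: summable_on_def)
    then show ?thesis
      unfolding abs_summable_on_def[symmetric] abs_summable_equivalent[symmetric]
      by (rule iffD1[OF summable_on_iff_abs_summable_on_real])
  qed
  have lim: "(\<lambda>n. c x * g x ^ n) \<longlonglongrightarrow> d x" if "x \<in> A" for x
  proof (cases "f x = r")
    case True
    then show ?thesis by (simp add: g_def d_def)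
  next
    case False
    then have "\<bar>g x\<bar> < 1" using g01[OF that] by (simp add: g_def)
    then show ?thesis
      using False tendsto_mult_right_zero[OF LIMSEQ_power_zero[of "g x"]] by (simp add: d_def)
  qed
  have bd: "norm (c x * g x ^ n) \<le> \<bar>c x\<bar>" if "x \<in> A" for x n
  proof -
    have "\<bar>g x ^ n\<bar> \<le> 1" using g01[OF that] by (simp add: power_abs power_le_one)
    then show ?thesis by (simp add: abs_mult mult_left_le)
  qed
  have ae_lim: "AE x in count_space A. (\<lambda>n. c x * g x ^ n) \<longlonglongrightarrow> d x"
    unfolding AE_count_space using lim by blast
  have ae_bd: "AE x in count_space A. norm (c x * g x ^ n) \<le> \<bar>c x\<bar>" for n
    unfolding AE_count_space using bd by blast
  have integral_infsum: "integral\<^sup>L (count_space A) h = infsum h A"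
    if "integrable (count_space A) h" for h :: "'a \<Rightarrow> real"
    using infsetsum_infsum that unfolding abs_summable_on_def infsetsum_def by blast
  note meas = borel_measurable_count_space borel_measurable_count_space
  note cv = integral_dominated_convergence[OF meas integrable_abs[OF c] ae_lim ae_bd]
  note id = integrable_dominated_convergence[OF meas integrable_abs[OF c] ae_lim ae_bd]
  note ig = integrable_dominated_convergence2[OF meas integrable_abs[OF c] ae_lim ae_bd]
  have "integral\<^sup>L (count_space A) (\<lambda>x. c x * g x ^ n) = 0" for n
    unfolding integral_infsum[OF ig] by (rule infsumI[OF g])
  then have "(\<lambda>n::nat. 0) \<longlonglongrightarrow> integral\<^sup>L (count_space A) d"
    using cv by (simp only:)
  then have "integral\<^sup>L (count_space A) d = 0"
    by (rule LIMSEQ_unique[OF _ tendsto_const])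
  then have "infsum d A = 0"
    unfolding integral_infsum[OF id] .
  moreover have "d summable_on A"
    using id unfolding abs_summable_on_def[symmetric] abs_summable_equivalent[symmetric]
    by (rule iffD2[OF summable_on_iff_abs_summable_on_real])
  ultimately have "(d has_sum 0) A" by (metis has_sum_infsum)
  then show ?thesis
    by (rule has_sum_cong_neutral[THEN iffD1, rotated -1]) (auto simp: d_def)
qed

text \<open>Without an opposite sign, multiplying by \<open>b x\<close> would make all terms
  nonnegative with sum zero, so the term at \<open>x\<close> would vanish.\<close>

lemma has_sum_zero_opposite_sign:
  fixes a b :: "'a \<Rightarrow> real"
  assumes sum: "((\<lambda>x. a x * b x) has_sum 0) A"
    and pos: "\<And>x. x \<in> A \<Longrightarrow> 0 < a x" and x: "x \<in> A" "b x \<noteq> 0"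
  shows "\<exists>y\<in>A. b x * b y < 0"
proof (rule ccontr)
  assume "\<not> ?thesis"
  then have "\<And>y. y \<in> A \<Longrightarrow> 0 \<le> b x * (a y * b y)"
    using pos by (metis less_le linorder_not_less mult.left_commute mult_nonneg_nonneg)
  moreover have "((\<lambda>y. b x * (a y * b y)) has_sum 0) A"
    using has_sum_cmult_right[OF sum, of "b x"] by simp
  ultimately have "b x * (a x * b x) = 0"
    using nonneg_has_sum_le_0D x(1) by fastforce
  then show False using x pos[OF x(1)] by simp
qed

section \<open>Common zeros of an irreducible polynomial and a second curve\<close>

lemma eval2_simps:
  "eval2 (P + R) x y = eval2 P x y + eval2 R x y"
  "eval2 (P - R) x y = eval2 P x y - eval2 R x y"
  "eval2 (P * R) x y = eval2 P x y * eval2 R x y"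
  "eval2 (pCons c P) x y = poly c x + y * eval2 P x y"
  "eval2 0 x y = 0"
  by (simp_all add: eval2_def)

text \<open>A nonzero polynomial in \<open>y\<close> over R[x] has finitely many roots in R[x],
  whereas the constants \<open>[:y:]\<close> are infinitely many.\<close>

lemma eval2_ext:
  assumes "\<And>x y. eval2 P x y = eval2 R x y"
  shows "P = R"
proof (rule ccontr)
  assume "P \<noteq> R"
  then have "finite {z. poly (P - R) z = 0}" by (intro poly_roots_finite) simp
  moreover have "poly P [:y:] = poly R [:y:]" for y
    using assms by (simp add: eval2_def poly_eq_poly_eq_iff[symmetric] fun_eq_iff)
  then have "range (\<lambda>y. [:y:]) \<subseteq> {z. poly (P - R) z = 0}" by auto
  ultimately have "finite (range (\<lambda>y::real. [:y:]))" by (rule finite_subset[rotated])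
  then have "finite (UNIV :: real set)" by (rule finite_imageD) (auto intro: inj_onI)
  then show False using infinite_UNIV_char_0 by blast
qed

text \<open>Elimination of \<open>y\<close>: the remainder \<open>R\<close> depends on
  \<open>x\<close> alone. It is nonzero, since otherwise the prime polynomial, of degree 2 in
  \<open>y\<close>, would divide a factor of degree 1. So \<open>x\<close> has finitely many values,
  and the linear equation determines \<open>y\<close>.\<close>

lemma finite_common_zeros_y:
  fixes q0 q1 q2 b :: "real poly"
  assumes prime: "prime_elem [:q0, q1, q2:]" and q2: "q2 \<noteq> 0"
  shows "finite {(x, y). eval2 [:q0, q1, q2:] x y = 0 \<and> poly b x + poly q2 x * y = 0 \<and> poly q2 x \<noteq> 0}"
    (is "finite ?Z")
proof -
  \<comment> \<open>\<open>R\<close> is the remainder when \<open>q2\<close> times the quadratic polynomial is divided by \<open>b + q2 y\<close>.\<close>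
  define R where "R = q0 * q2 - b * q1 + b * b"
  have id: "[:q2:] * [:q0, q1, q2:] = [:b, q2:] * [:q1 - b, q2:] + [:R:]"
    by (simp add: R_def algebra_simps)
  have "R \<noteq> 0"
  proof
    assume "R = 0"
    then have "[:q0, q1, q2:] dvd [:b, q2:] * [:q1 - b, q2:]"
      using id by (metis add_0_right dvd_triv_right pCons_0_0)
    then consider "[:q0, q1, q2:] dvd [:b, q2:]" | "[:q0, q1, q2:] dvd [:q1 - b, q2:]"
      using prime prime_elem_dvd_mult_iff by blast
    then show False
      by cases (use q2 in \<open>auto dest!: dvd_imp_degree_le\<close>)
  qed
  have "?Z \<subseteq> (\<lambda>x. (x, - poly b x / poly q2 x)) ` {x. poly R x = 0}"
  proof (safe)
    fix x y
    assume *: "eval2 [:q0, q1, q2:] x y = 0" "poly b x + poly q2 x * y = 0" "poly q2 x \<noteq> 0"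
    have "poly q2 x * eval2 [:q0, q1, q2:] x y
        = (poly b x + poly q2 x * y) * (poly q1 x - poly b x + poly q2 x * y) + poly R x"
      by (simp add: eval2_simps R_def algebra_simps)
    then have "poly R x = 0" using * by simp
    moreover have "y = - poly b x / poly q2 x" using * by (simp add: field_simps)
    ultimately show "(x, y) \<in> (\<lambda>x. (x, - poly b x / poly q2 x)) ` {x. poly R x = 0}" by blast
  qed
  then show ?thesis by (rule finite_subset) (simp add: poly_roots_finite \<open>R \<noteq> 0\<close>)
qed

text \<open>Elimination of \<open>x\<close> in the same way. As \<open>x\<close> is the inner
  variable, \<open>Q\<close> is described by its values and the division identity is checked
  pointwise.\<close>

lemma finite_common_zeros_x:
  fixes Q :: "real poly poly" and r0 r1 r2 b :: "real poly"
  assumes prime: "prime_elem Q"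
    and Q: "\<And>x y. eval2 Q x y = poly r0 y + poly r1 y * x + poly r2 y * x^2"
    and r2: "poly r2 y0 \<noteq> 0"
  shows "finite {(x, y). eval2 Q x y = 0 \<and> poly b y + poly r2 y * x = 0 \<and> poly r2 y \<noteq> 0}"
    (is "finite ?Z")
proof -
  define R where "R = r0 * r2 - b * r1 + b * b"
  define \<iota> where "\<iota> r = map_poly (\<lambda>c. [:c:]) r" for r :: "real poly"
  have \<iota>: "poly (\<iota> r) [:y:] = [:poly r y:]" for r y
    unfolding \<iota>_def by (induction r) (simp_all add: map_poly_pCons)
  have e\<iota>: "eval2 (\<iota> r) x y = poly r y" for r x y by (simp add: eval2_def \<iota>)
  define X :: "real poly poly" where "X = [:[:0, 1:]:]"
  have eX: "eval2 X x y = x" for x y by (simp add: eval2_def X_def)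
  have R: "poly r2 y * eval2 Q x y
      = (poly b y + poly r2 y * x) * (poly r1 y - poly b y + poly r2 y * x) + poly R y" for x y
    by (simp add: Q R_def algebra_simps power2_eq_square)
  have id: "\<iota> r2 * Q = (\<iota> b + \<iota> r2 * X) * (\<iota> (r1 - b) + \<iota> r2 * X) + \<iota> R"
    by (rule eval2_ext) (simp add: eval2_simps e\<iota> eX R)
  have Qy: "poly Q [:y:] = [:poly r0 y, poly r1 y, poly r2 y:]" for y
    by (subst poly_eq_poly_eq_iff[symmetric])
      (simp add: Q[unfolded eval2_def] fun_eq_iff algebra_simps power2_eq_square)
  \<comment> \<open>At \<open>y = y0\<close> the left side has degree 2 in \<open>x\<close> and the
    right side degree 1, because \<open>r2\<close> does not vanish there.\<close>
  have nd: "\<not> Q dvd \<iota> a + \<iota> r2 * X" for a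
  proof
    assume "Q dvd \<iota> a + \<iota> r2 * X"
    then obtain S where "\<iota> a + \<iota> r2 * X = Q * S" by (rule dvdE)
    then have "poly (\<iota> a + \<iota> r2 * X) [:y0:] = poly Q [:y0:] * poly S [:y0:]" by simp
    then have "poly Q [:y0:] dvd [:poly a y0, poly r2 y0:]"
      by (simp add: \<iota> X_def)
    then show False using r2 by (auto simp: Qy dest!: dvd_imp_degree_le)
  qed
  have "R \<noteq> 0"
  proof
    assume "R = 0"
    then have "Q dvd (\<iota> b + \<iota> r2 * X) * (\<iota> (r1 - b) + \<iota> r2 * X)"
      using id by (metis \<iota>_def add_0_right dvd_triv_right map_poly_0)
    then show False using prime prime_elem_dvd_mult_iff nd by blast
  qed
  have "?Z \<subseteq> (\<lambda>y. (- poly b y / poly r2 y, y)) ` {y. poly R y = 0}"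
  proof safe
    fix x y
    assume *: "eval2 Q x y = 0" "poly b y + poly r2 y * x = 0" "poly r2 y \<noteq> 0"
    then have "poly R y = 0" using R[of y x] by simp
    moreover have "x = - poly b y / poly r2 y" using * by (simp add: field_simps)
    ultimately show "(x, y) \<in> (\<lambda>y. (- poly b y / poly r2 y, y)) ` {y. poly R y = 0}" by blast
  qed
  then show ?thesis by (rule finite_subset) (simp add: poly_roots_finite \<open>R \<noteq> 0\<close>)
qed

section \<open>The kernel and its convexity\<close>

text \<open>Clearing denominators in Q turns a step \<open>s\<close> into the power 1 - s, so
  \<open>c (-1)\<close> is the coefficient of the square.\<close>

definition quad :: "(int \<Rightarrow> real) \<Rightarrow> real \<Rightarrow> real" where
  "quad c x = c 1 + c 0 * x + c (-1) * x^2"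

text \<open>The polynomial Q as a quadratic in \<open>y\<close>, for arbitrary weights.\<close>

definition kernel :: "(int \<Rightarrow> int \<Rightarrow> real) \<Rightarrow> real \<Rightarrow> real \<Rightarrow> real" where
  "kernel p x y = quad (\<lambda>s. p s 1) x + (quad (\<lambda>s. p s 0) x - x) * y + quad (\<lambda>s. p s (-1)) x * y^2"

text \<open>The defect of $\rho^i\sigma^j$ in the horizontal balance equation, divided by $\rho^{i-1}$ and
  read at $(\rho,\sigma)=(x,y)$. Columns and rows are exchanged by transposing \<open>p\<close>, so the vertical
  defect is \<open>bal (transp_p p) v y x\<close>.\<close>

definition bal :: "(int \<Rightarrow> int \<Rightarrow> real) \<Rightarrow> (int \<Rightarrow> real) \<Rightarrow> real \<Rightarrow> real \<Rightarrow> real" where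
  "bal p h x y = quad (\<lambda>s. p s (-1)) x * y + quad h x - x"

abbreviation (input) transp_p :: "(int \<Rightarrow> int \<Rightarrow> real) \<Rightarrow> int \<Rightarrow> int \<Rightarrow> real" where
  "transp_p p \<equiv> \<lambda>s t. p t s"

lemma kernel_transp: "kernel (transp_p p) y x = kernel p x y"
  by (simp add: kernel_def quad_def algebra_simps power2_eq_square)

lemma sum_pm1: "(\<Sum>s = -1..1::int. f s) = f (-1) + f 0 + (f 1 :: 'a :: comm_monoid_add)"
proof -
  have "{-1..1::int} = {-1, 0, 1}" by auto
  then show ?thesis by (simp add: add.assoc)
qed

text \<open>Vieta's formula for the product of the roots in \<open>y\<close>, multiplied by the
  leading coefficient.\<close>

lemma two_roots:
  assumes "kernel p x y = 0" "kernel p x y' = 0" "y \<noteq> y'"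
  shows "quad (\<lambda>s. p s (-1)) x * y * y' = quad (\<lambda>s. p s 1) x"
proof -
  have "(y - y') * (quad (\<lambda>s. p s (-1)) x * y * y' - quad (\<lambda>s. p s 1) x)
      = y' * kernel p x y - y * kernel p x y'" 
    by (simp add: kernel_def algebra_simps power2_eq_square)
  then show ?thesis using assms by simp
qed

section \<open>Tangent planes in the coordinates ln x and ln y\<close>

lemma exp_tangent:
  fixes a b z w :: real
  assumes "0 < z" "0 < w"
  shows "z + z * (ln w - ln z) \<le> w" and "w = z + z * (ln w - ln z) \<Longrightarrow> ln w = ln z"
proof -
  \<comment> \<open>This says that exp lies above its tangent at \<open>ln z\<close>; contact occurs
    only for \<open>w / z = 1\<close>.\<close>
  have "ln (w / z) \<le> w / z - 1" using assms by (intro ln_le_minus_one) simp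
  then show "z + z * (ln w - ln z) \<le> w"
    using assms by (simp add: ln_div field_simps)
  assume "w = z + z * (ln w - ln z)"
  then have "ln (w / z) = w / z - 1" using assms by (simp add: ln_div field_simps)
  then have "w / z = 1" using assms by (intro ln_eq_minus_one) simp_all
  then show "ln w = ln z" using assms by simp
qed

text \<open>In the coordinates ln x and ln y this is the exponential of a linear form, hence
  convex.\<close>

definition lmon :: "real \<Rightarrow> real \<Rightarrow> int \<Rightarrow> int \<Rightarrow> real" where
  "lmon x y s t = x powi (-s) * y powi (-t)"

lemma lmon_pos: "0 < x \<Longrightarrow> 0 < y \<Longrightarrow> 0 < lmon x y s t"
  by (simp add: lmon_def)

lemma ln_powi: "0 < x \<Longrightarrow> ln (x powi n) = of_int n * ln (x :: real)"
  by (simp add: power_int_def ln_realpow ln_inverse)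

lemma ln_lmon: "0 < x \<Longrightarrow> 0 < y \<Longrightarrow> ln (lmon x y s t) = - of_int s * ln x - of_int t * ln y"
  by (simp add: lmon_def ln_mult ln_powi)

lemma lmon_times:
  assumes "0 < x" "0 < y" and "s \<in> {-1..1}" "t \<in> {-1..1}"
  shows "x * y * lmon x y s t = x ^ nat (1 - s) * y ^ nat (1 - t)"
proof -
  have "z * z powi (- r) = z ^ nat (1 - r)" if "0 < z" "r \<in> {-1..1}" for z :: real and r
  proof -
    have "r \<in> {-1, 0, 1}" using that by auto
    then show ?thesis using that(1) by (auto simp: power_int_minus power2_eq_square)
  qed
  then have "(x * x powi (-s)) * (y * y powi (-t)) = x ^ nat (1 - s) * y ^ nat (1 - t)"
    using assms by simp
  then show ?thesis by (simp only: lmon_def mult.assoc mult.left_commute)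
qed

lemma sum_lmon_times:
  assumes "0 < x" "0 < y"
  shows "x * y * (\<Sum>s=-1..1. \<Sum>t=-1..1. c s t * lmon x y s t)
    = (\<Sum>s=-1..1. \<Sum>t=-1..1. c s t * (x ^ nat (1 - s) * y ^ nat (1 - t)))"
proof -
  have "x * y * (c s t * lmon x y s t) = c s t * (x ^ nat (1 - s) * y ^ nat (1 - t))"
    if "s \<in> {-1..1}" "t \<in> {-1..1}" for s t
    using lmon_times[OF assms that] by (simp add: mult.left_commute)
  then show ?thesis unfolding sum_distrib_left by (intro sum.cong refl)
qed

lemma kernel_lmon:
  assumes "0 < x" "0 < y"
  shows "kernel p x y = x * y * ((\<Sum>s=-1..1. \<Sum>t=-1..1. p s t * lmon x y s t) - 1)"
  unfolding right_diff_distrib sum_lmon_times[OF assms]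
  by (simp add: sum_pm1 kernel_def quad_def algebra_simps power2_eq_square)

text \<open>Differentiating \<open>lmon\<close> in ln x multiplies it by -s, so this is x y times a
  partial derivative of the weighted sum. \<open>dy_lmon\<close> is its counterpart for ln
  y.\<close>

lemma dx_lmon:
  assumes "0 < x" "0 < y"
  shows "x * y * (\<Sum>s=-1..1. \<Sum>t=-1..1. p s t * lmon x y s t * - of_int s)
     = quad (\<lambda>t. p (-1) t) y * x^2 - quad (\<lambda>t. p 1 t) y"
  using sum_lmon_times[OF assms, of "\<lambda>s t. p s t * - of_int s"]
  by (simp add: sum_pm1 quad_def algebra_simps power2_eq_square)

lemma dy_lmon:
  assumes "0 < x" "0 < y"
  shows "x * y * (\<Sum>s=-1..1. \<Sum>t=-1..1. p s t * lmon x y s t * - of_int t)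
     = quad (\<lambda>s. p s (-1)) x * y^2 - quad (\<lambda>s. p s 1) x"
  using sum_lmon_times[OF assms, of "\<lambda>s t. p s t * - of_int t"]
  by (simp add: sum_pm1 quad_def algebra_simps power2_eq_square)

text \<open>\<open>T s t\<close> is the tangent plane of one weighted monomial at (ln x, ln y),
  taken at (ln x', ln y'). Contact forces equal exponents at both points.\<close>

lemma lmon_tangent:
  assumes p: "\<And>s t. 0 \<le> p s t" and pos: "0 < x" "0 < y" "0 < x'" "0 < y'"
  defines "G \<equiv> \<lambda>x y s t. p s t * lmon x y s t"
  defines "T \<equiv> \<lambda>s t. G x y s t + G x y s t * (- of_int s * (ln x' - ln x) - of_int t * (ln y' - ln y))"
  shows "T s t \<le> G x' y' s t"
    and "T s t = G x' y' s t \<Longrightarrow> p s t \<noteq> 0 \<Longrightarrow> s * (ln x' - ln x) + t * (ln y' - ln y) = 0"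
proof -
  let ?z = "lmon x y s t" and ?w = "lmon x' y' s t"
  have z: "0 < ?z" "0 < ?w" using pos by (simp_all add: lmon_pos)
  have d: "- of_int s * (ln x' - ln x) - of_int t * (ln y' - ln y) = ln ?w - ln ?z"
    using pos by (simp add: ln_lmon algebra_simps)
  have T: "T s t = p s t * (?z + ?z * (ln ?w - ln ?z))"
    unfolding T_def G_def d by (simp add: algebra_simps)
  show "T s t \<le> G x' y' s t"
    unfolding T G_def by (intro mult_left_mono exp_tangent z p)
  assume "T s t = G x' y' s t" "p s t \<noteq> 0"
  then have "ln ?w = ln ?z" using exp_tangent(2)[OF z] unfolding T G_def by simp
  then show "s * (ln x' - ln x) + t * (ln y' - ln y) = 0" using d by simp
qed

lemma lmon_sum_tangent:
  assumes "0 < x" "0 < y"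
  shows "(\<Sum>s=-1..1. \<Sum>t=-1..1. p s t * lmon x y s t + p s t * lmon x y s t * (- of_int s * u - of_int t * v))
    = 1 + (kernel p x y + u * (quad (\<lambda>t. p (-1) t) y * x^2 - quad (\<lambda>t. p 1 t) y)
       + v * (quad (\<lambda>s. p s (-1)) x * y^2 - quad (\<lambda>s. p s 1) x)) / (x * y)"
  unfolding kernel_lmon[OF assms] dx_lmon[OF assms, symmetric] dy_lmon[OF assms, symmetric]
  using assms by (simp add: sum_pm1 field_simps)

text \<open>At a critical zero the tangent plane is constantly 1. A second zero also has value 1, so
  every tangent inequality is an equality and the displacement is orthogonal to each step of nonzero
  weight.\<close>

lemma kernel_critical_unique:
  assumes p: "\<And>s t. 0 \<le> p s t" and pos: "0 < x" "0 < y" and Q: "kernel p x y = 0"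
    and dx: "quad (\<lambda>t. p (-1) t) y * x^2 = quad (\<lambda>t. p 1 t) y"
    and dy: "quad (\<lambda>s. p s (-1)) x * y^2 = quad (\<lambda>s. p s 1) x"
    and z: "0 < x'" "0 < y'" "kernel p x' y' = 0"
    and st: "p s t \<noteq> 0" "s \<in> {-1..1}" "t \<in> {-1..1}"
  shows "s * (ln x' - ln x) + t * (ln y' - ln y) = 0"
proof -
  let ?T = "\<lambda>s t. p s t * lmon x y s t + p s t * lmon x y s t *
       (- of_int s * (ln x' - ln x) - of_int t * (ln y' - ln y))"
  let ?G = "\<lambda>s t. p s t * lmon x' y' s t"
  note le = lmon_tangent(1)[where p = p, OF p pos z(1,2)]
  have "(\<Sum>s=-1..1. \<Sum>t=-1..1. ?T s t) = 1"
    unfolding lmon_sum_tangent[OF pos] using Q dx dy by simp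
  moreover have "(\<Sum>s=-1..1. \<Sum>t=-1..1. ?G s t) = 1"
    using kernel_lmon[OF z(1,2), of p] z by simp
  ultimately have "(\<Sum>s=-1..1. \<Sum>t=-1..1. ?G s t - ?T s t) = 0"
    by (simp add: sum_subtractf)
  then have "(\<Sum>z\<in>{-1..1}\<times>{-1..1}. ?G (fst z) (snd z) - ?T (fst z) (snd z)) = 0"
    by (simp add: sum.cartesian_product case_prod_beta)
  then have "\<forall>z\<in>{-1..1}\<times>{-1..1}. ?G (fst z) (snd z) - ?T (fst z) (snd z) = 0"
    by (subst (asm) sum_nonneg_eq_0_iff) (use le in auto)
  then have "?T s t = ?G s t" using st by fastforce
  then show ?thesis using lmon_tangent(2)[where p = p, OF p pos z(1,2)] st by simp
qed

text \<open>With both partners smaller, Vieta makes both slopes positive, so the tangent plane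
  exceeds 1 at the point (1,1). There the weighted sum equals the sum of \<open>p\<close>, which is
  at most 1.\<close>

lemma no_upper_right_corner:
  assumes p: "\<And>s t. 0 \<le> p s t" and le1: "(\<Sum>s=-1..1. \<Sum>t=-1..1. p s t) \<le> 1"
    and pos: "0 < x" "0 < y" "x < 1" "y < 1" and Q: "kernel p x y = 0"
    and x': "x' < x" "kernel p x' y = 0" and y': "y' < y" "kernel p x y' = 0"
    and A: "0 < quad (\<lambda>t. p (-1) t) y" "0 < quad (\<lambda>s. p s (-1)) x"
  shows False
proof -
  let ?dx = "quad (\<lambda>t. p (-1) t) y * x^2 - quad (\<lambda>t. p 1 t) y"
  let ?dy = "quad (\<lambda>s. p s (-1)) x * y^2 - quad (\<lambda>s. p s 1) x"
  have "quad (\<lambda>s. p s (-1)) x * y * y' = quad (\<lambda>s. p s 1) x"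
    using two_roots[OF Q y'(2)] y'(1) by simp
  then have "?dy = quad (\<lambda>s. p s (-1)) x * y * (y - y')"
    by (simp add: algebra_simps power2_eq_square)
  then have dy: "0 < ?dy" using A pos y' by simp
  have "quad (\<lambda>t. p (-1) t) y * x * x' = quad (\<lambda>t. p 1 t) y"
    using two_roots[OF trans[OF kernel_transp Q] trans[OF kernel_transp x'(2)]] x'(1) by simp
  then have "?dx = quad (\<lambda>t. p (-1) t) y * x * (x - x')"
    by (simp add: algebra_simps power2_eq_square)
  then have dx: "0 < ?dx" using A pos x' by simp
  let ?T = "\<lambda>s t. p s t * lmon x y s t + p s t * lmon x y s t *
       (- of_int s * (ln 1 - ln x) - of_int t * (ln 1 - ln y))"
  have "(\<Sum>s=-1..1. \<Sum>t=-1..1. ?T s t) \<le> (\<Sum>s=-1..1. \<Sum>t=-1..1. p s t * lmon 1 1 s t)"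
    by (intro sum_mono lmon_tangent(1)[where p = p, OF p] pos) simp_all
  also have "\<dots> \<le> 1" using le1 by (simp add: lmon_def)
  finally have "(\<Sum>s=-1..1. \<Sum>t=-1..1. ?T s t) \<le> 1" .
  then have "(- ln x * ?dx + - ln y * ?dy) / (x * y) \<le> 0"
    unfolding lmon_sum_tangent[OF pos(1,2)] using Q by simp
  moreover have "0 < (- ln x * ?dx + - ln y * ?dy) / (x * y)"
    using pos dx dy by (intro divide_pos_pos add_pos_pos mult_pos_pos) simp_all
  ultimately show False by linarith
qed

section \<open>Staircases of partners\<close>

lemma tendsto_quad [tendsto_intros]:
  "(f \<longlongrightarrow> a) F \<Longrightarrow> ((\<lambda>n. quad c (f n)) \<longlongrightarrow> quad c a) F"
  unfolding quad_def by (intro tendsto_intros)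

lemma tendsto_kernel [tendsto_intros]:
  "(f \<longlongrightarrow> a) F \<Longrightarrow> (g \<longlongrightarrow> b) F \<Longrightarrow> ((\<lambda>n. kernel p (f n) (g n)) \<longlongrightarrow> kernel p a b) F"
  unfolding kernel_def by (intro tendsto_intros)

lemma tendsto_bal [tendsto_intros]:
  "(f \<longlongrightarrow> a) F \<Longrightarrow> (g \<longlongrightarrow> b) F \<Longrightarrow> ((\<lambda>n. bal p h (f n) (g n)) \<longlongrightarrow> bal p h a b) F"
  unfolding bal_def by (intro tendsto_intros)

lemma limit_nonpos_if_frequently_nonpos:
  fixes f :: "nat \<Rightarrow> real"
  assumes "f \<longlonglongrightarrow> L" "\<exists>\<^sub>F n in sequentially. f n \<le> 0"
  shows "L \<le> 0"
proof (rule ccontr)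
  assume "\<not> L \<le> 0"
  then have "\<forall>\<^sub>F n in sequentially. 0 < f n" using order_tendstoD(1)[OF assms(1), of 0] by simp
  then show False using assms(2) by (simp add: frequently_def not_le)
qed

lemma limit_zero_if_frequently_zero:
  fixes f :: "nat \<Rightarrow> real"
  assumes f: "f \<longlonglongrightarrow> L" and z: "\<exists>\<^sub>F n in sequentially. f n = 0"
  shows "L = 0"
proof -
  have "L \<le> 0" by (rule limit_nonpos_if_frequently_nonpos[OF f]) (rule frequently_mono[OF _ z], simp)
  moreover have "- L \<le> 0"
    by (rule limit_nonpos_if_frequently_nonpos[OF tendsto_minus[OF f]]) (rule frequently_mono[OF _ z], simp)
  ultimately show ?thesis by simp
qed

text \<open>The zero at \<open>(0, y0)\<close> annihilates the weights \<open>p 1 t\<close>, so the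
  product of the roots in \<open>x\<close> is zero on the row of \<open>y\<close>, contrary to two
  positive roots.\<close>

lemma no_kernel_zero_on_axis:
  assumes p: "\<And>s t. 0 \<le> p s t" and y0: "0 < y0" "kernel p 0 y0 = 0"
    and xs: "0 < x" "0 < x'" "x \<noteq> x'" and k: "kernel p x y = 0" "kernel p x' y = 0"
    and a: "0 < quad (\<lambda>t. p (-1) t) y"
  shows False
proof -
  have "p 1 1 + p 1 0 * y0 + p 1 (-1) * y0^2 = 0"
    using y0(2) by (simp add: kernel_def quad_def)
  then have "p 1 1 = 0 \<and> p 1 0 = 0 \<and> p 1 (-1) = 0"
    using y0(1) p by (simp add: add_nonneg_eq_0_iff add_nonneg_nonneg)
  then have "quad (\<lambda>t. p 1 t) y = 0" by (simp add: quad_def)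
  moreover have "quad (\<lambda>t. p (-1) t) y * x * x' = quad (\<lambda>t. p 1 t) y"
    using two_roots[OF trans[OF kernel_transp k(1)] trans[OF kernel_transp k(2)] xs(3)] .
  ultimately show False using a xs by simp
qed

text \<open>What the staircase argument uses of the walk. \<open>column\<close> and
  \<open>row\<close> will come from positive coefficients \<alpha>.\<close>

locale balanced_points =
  fixes p :: "int \<Rightarrow> int \<Rightarrow> real" and h v :: "int \<Rightarrow> real" and G :: "(real \<times> real) set"
  assumes p_nonneg: "\<And>s t. 0 \<le> p s t"
    and p_le_1: "(\<Sum>s=-1..1. \<Sum>t=-1..1. p s t) \<le> 1"
    and a_y: "\<And>x. 0 < x \<Longrightarrow> 0 < quad (\<lambda>s. p s (-1)) x"
    and a_x: "\<And>y. 0 < y \<Longrightarrow> 0 < quad (\<lambda>t. p (-1) t) y"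
    and origin: "p 1 1 \<noteq> 0 \<or> h 1 \<noteq> 0 \<or> v 1 \<noteq> 0"
    and unit: "\<And>x y. (x, y) \<in> G \<Longrightarrow> 0 < x \<and> x < 1 \<and> 0 < y \<and> y < 1"
    and zero: "\<And>x y. (x, y) \<in> G \<Longrightarrow> kernel p x y = 0"
    and column: "\<And>x y. (x, y) \<in> G \<Longrightarrow> bal p h x y \<noteq> 0 \<Longrightarrow>
          \<exists>y'. (x, y') \<in> G \<and> bal p h x y * bal p h x y' < 0"
    and row: "\<And>x y. (x, y) \<in> G \<Longrightarrow> bal (transp_p p) v y x \<noteq> 0 \<Longrightarrow>
          \<exists>x'. (x', y) \<in> G \<and> bal (transp_p p) v y x * bal (transp_p p) v y x' < 0"
begin

text \<open>The opposite signs are recorded because they exclude a limit at the origin.\<close>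

definition up :: "((real \<times> real) \<times> (real \<times> real)) set" where
  "up = {((x, y), (x', y')). x = x' \<and> y < y' \<and> (x, y) \<in> G \<and> (x', y') \<in> G \<and>
      bal p h x y * bal p h x' y' < 0}"

definition right :: "((real \<times> real) \<times> (real \<times> real)) set" where
  "right = {((x, y), (x', y')). y = y' \<and> x < x' \<and> (x, y) \<in> G \<and> (x', y') \<in> G \<and>
      bal (transp_p p) v y x * bal (transp_p p) v y' x' < 0}"

section \<open>Uniqueness of partners and exclusion of infinite staircases\<close>

lemma column_roots:
  assumes "(x, y) \<in> G" "(x, y') \<in> G" "y \<noteq> y'"
  shows "quad (\<lambda>s. p s (-1)) x * y * y' = quad (\<lambda>s. p s 1) x"
  using two_roots[OF zero[OF assms(1)] zero[OF assms(2)] assms(3)] .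

lemma row_roots:
  assumes "(x, y) \<in> G" "(x', y) \<in> G" "x \<noteq> x'"
  shows "quad (\<lambda>t. p (-1) t) y * x * x' = quad (\<lambda>t. p 1 t) y"
  using two_roots[OF trans[OF kernel_transp zero[OF assms(1)]]
      trans[OF kernel_transp zero[OF assms(2)]] assms(3)] .

lemma column_unique:
  assumes "(x, y) \<in> G" "(x, y') \<in> G" "(x, y'') \<in> G" "y \<noteq> y'" "y \<noteq> y''"
  shows "y' = y''"
proof -
  have "quad (\<lambda>s. p s (-1)) x * y * y' = quad (\<lambda>s. p s (-1)) x * y * y''"
    using column_roots[OF assms(1,2,4)] column_roots[OF assms(1,3,5)] by simp
  then show ?thesis using a_y[of x] unit[OF assms(1)] by simp
qed

lemma row_unique:
  assumes "(x, y) \<in> G" "(x', y) \<in> G" "(x'', y) \<in> G" "x \<noteq> x'" "x \<noteq> x''"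
  shows "x' = x''"
proof -
  have "quad (\<lambda>t. p (-1) t) y * x * x' = quad (\<lambda>t. p (-1) t) y * x * x''"
    using row_roots[OF assms(1,2,4)] row_roots[OF assms(1,3,5)] by simp
  then show ?thesis using a_x[of y] unit[OF assms(1)] by simp
qed

text \<open>Partners coalesce in the limit, where Vieta's formula, valid along infinitely many steps
  of either kind, turns into the vanishing of both slopes. The possible positions of the limit are
  excluded one by one.\<close>

lemma no_convergent_staircase:
  assumes X: "X \<longlonglongrightarrow> a" and Y: "Y \<longlonglongrightarrow> b"
    and V: "\<exists>\<^sub>F n in sequentially. ((X n, Y n), (X (Suc n), Y (Suc n))) \<in> up \<union> up\<inverse>"
    and H: "\<exists>\<^sub>F n in sequentially. ((X n, Y n), (X (Suc n), Y (Suc n))) \<in> right \<union> right\<inverse>"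
    and G: "\<And>n. (X n, Y n) \<in> G"
  shows False
proof -
  note X' = LIMSEQ_Suc[OF X] and Y' = LIMSEQ_Suc[OF Y]
  have "\<exists>n. ((X n, Y n), (X (Suc n), Y (Suc n))) \<in> up \<union> up\<inverse>"
    using frequently_ex[OF V] .
  then obtain x y y' where xy: "(x, y) \<in> G" "(x, y') \<in> G" "y \<noteq> y'"
    by (fastforce simp: up_def)
  have "\<exists>n. ((X n, Y n), (X (Suc n), Y (Suc n))) \<in> right \<union> right\<inverse>"
    using frequently_ex[OF H] .
  then obtain z w w' where wz: "(w, z) \<in> G" "(w', z) \<in> G" "w \<noteq> w'"
    by (fastforce simp: right_def)
  have ab: "0 \<le> a" "0 \<le> b"
    by (rule LIMSEQ_le_const[OF X], meson unit[OF G] less_imp_le)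
      (rule LIMSEQ_le_const[OF Y], meson unit[OF G] less_imp_le)
  have "(\<lambda>n. kernel p (X n) (Y n)) \<longlonglongrightarrow> kernel p a b" by (intro tendsto_intros X Y)
  then have k: "kernel p a b = 0" using zero[OF G] LIMSEQ_unique[OF _ tendsto_const] by fastforce
  have "quad (\<lambda>s. p s (-1)) a * b * b - quad (\<lambda>s. p s 1) a = 0"
  proof (rule limit_zero_if_frequently_zero)
    show "(\<lambda>n. quad (\<lambda>s. p s (-1)) (X n) * Y n * Y (Suc n) - quad (\<lambda>s. p s 1) (X n))
        \<longlonglongrightarrow> quad (\<lambda>s. p s (-1)) a * b * b - quad (\<lambda>s. p s 1) a"
      by (intro tendsto_intros X Y Y')
    show "\<exists>\<^sub>F n in sequentially. quad (\<lambda>s. p s (-1)) (X n) * Y n * Y (Suc n) - quad (\<lambda>s. p s 1) (X n) = 0"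
      by (rule frequently_mono[OF _ V]) (auto simp: up_def intro!: column_roots)
  qed
  then have dy: "quad (\<lambda>s. p s (-1)) a * b^2 = quad (\<lambda>s. p s 1) a"
    by (simp add: power2_eq_square)
  have "quad (\<lambda>t. p (-1) t) b * a * a - quad (\<lambda>t. p 1 t) b = 0"
  proof (rule limit_zero_if_frequently_zero)
    show "(\<lambda>n. quad (\<lambda>t. p (-1) t) (Y n) * X n * X (Suc n) - quad (\<lambda>t. p 1 t) (Y n))
        \<longlonglongrightarrow> quad (\<lambda>t. p (-1) t) b * a * a - quad (\<lambda>t. p 1 t) b"
      by (intro tendsto_intros X Y X')
    show "\<exists>\<^sub>F n in sequentially. quad (\<lambda>t. p (-1) t) (Y n) * X n * X (Suc n) - quad (\<lambda>t. p 1 t) (Y n) = 0"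
      by (rule frequently_mono[OF _ H]) (auto simp: right_def intro!: row_roots)
  qed
  then have dx: "quad (\<lambda>t. p (-1) t) b * a^2 = quad (\<lambda>t. p 1 t) b"
    by (simp add: power2_eq_square)
  consider "0 < a" "0 < b" | "a = 0" "0 < b" | "0 < a" "b = 0" | "a = 0" "b = 0"
    using ab by fastforce
  then show False
  proof cases
    case 1
    \<comment> \<open>The limit is critical. Two points of one column share ln x, so orthogonality
      to a step (s, -1) of nonzero weight equates their ln y.\<close>
    have "0 < p 1 (-1) + p 0 (-1) + p (-1) (-1)" using a_y[of 1] by (simp add: quad_def)
    then have "p 1 (-1) \<noteq> 0 \<or> p 0 (-1) \<noteq> 0 \<or> p (-1) (-1) \<noteq> 0" by linarith
    then obtain s where s: "p s (-1) \<noteq> 0" "s \<in> {-1..1}" by fastforce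
    have *: "s * (ln x - ln a) + (-1) * (ln u - ln b) = 0" if "(x, u) \<in> G" for u
      using kernel_critical_unique[where p = p, OF p_nonneg 1 k dx dy _ _ zero[OF that] s] unit[OF that]
      by simp
    have "ln y = ln y'" using *[OF xy(1)] *[OF xy(2)] by simp
    then show False using unit[OF xy(1)] unit[OF xy(2)] xy(3) by simp
  next
    case 2
    \<comment> \<open>The row pair \<open>w\<close>, \<open>w'\<close> supplies two positive roots;
      on the other axis the column pair does so for the transposed weights.\<close>
    show False
      using no_kernel_zero_on_axis[where p = p, OF p_nonneg 2(2) _ _ _ wz(3) zero[OF wz(1)] zero[OF wz(2)] a_x]
        k 2 unit[OF wz(1)] unit[OF wz(2)] by simp
  next
    case 3
    have "kernel (transp_p p) 0 a = 0" using k 3 by (subst kernel_transp) simp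
    then show False
      using no_kernel_zero_on_axis[where p = "transp_p p", OF p_nonneg 3(1) _ _ _ xy(3)
          trans[OF kernel_transp zero[OF xy(1)]] trans[OF kernel_transp zero[OF xy(2)]] a_y]
        unit[OF xy(1)] unit[OF xy(2)] by simp
  next
    case 4
    \<comment> \<open>At the origin the horizontal defect is \<open>h 1\<close>. Products of
      consecutive defects are infinitely often negative, so its square is at most 0.\<close>
    have "bal p h a b * bal p h a b \<le> 0"
    proof (rule limit_nonpos_if_frequently_nonpos)
      show "(\<lambda>n. bal p h (X n) (Y n) * bal p h (X (Suc n)) (Y (Suc n))) \<longlonglongrightarrow> bal p h a b * bal p h a b"
        by (intro tendsto_intros X Y X' Y')
      show "\<exists>\<^sub>F n in sequentially. bal p h (X n) (Y n) * bal p h (X (Suc n)) (Y (Suc n)) \<le> 0"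
        by (rule frequently_mono[OF _ V]) (auto simp: up_def mult.commute)
    qed
    then have "h 1 = 0" using 4 by (auto simp: bal_def quad_def mult_le_0_iff)
    have "bal (transp_p p) v b a * bal (transp_p p) v b a \<le> 0"
    proof (rule limit_nonpos_if_frequently_nonpos)
      show "(\<lambda>n. bal (transp_p p) v (Y n) (X n) * bal (transp_p p) v (Y (Suc n)) (X (Suc n)))
          \<longlonglongrightarrow> bal (transp_p p) v b a * bal (transp_p p) v b a"
        by (intro tendsto_intros X Y X' Y')
      show "\<exists>\<^sub>F n in sequentially. bal (transp_p p) v (Y n) (X n) * bal (transp_p p) v (Y (Suc n)) (X (Suc n)) \<le> 0"
        by (rule frequently_mono[OF _ H]) (auto simp: right_def mult.commute)
    qed
    then have "v 1 = 0" using 4 by (auto simp: bal_def quad_def mult_le_0_iff)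
    moreover have "p 1 1 = 0" using k 4 by (simp add: kernel_def quad_def)
    ultimately show False using origin \<open>h 1 = 0\<close> by simp
  qed
qed

text \<open>Two vertical steps in succession would return to their start by
  \<open>column_unique\<close>, which monotonicity forbids; likewise for horizontal ones. So both
  kinds occur infinitely often, and bounded monotone coordinates converge.\<close>

lemma no_monotone_staircase:
  assumes X: "monoseq X" and Y: "monoseq Y" and G: "\<And>n. (X n, Y n) \<in> G"
    and step: "\<And>n. ((X n, Y n), (X (Suc n), Y (Suc n))) \<in> (up \<union> up\<inverse>) \<union> (right \<union> right\<inverse>)"
  shows False
proof -
  have V: "\<not> (((X n, Y n), (X (Suc n), Y (Suc n))) \<in> up \<union> up\<inverse> \<and>
      ((X (Suc n), Y (Suc n)), (X (Suc (Suc n)), Y (Suc (Suc n)))) \<in> up \<union> up\<inverse>)" for n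
  proof
    assume *: "((X n, Y n), (X (Suc n), Y (Suc n))) \<in> up \<union> up\<inverse> \<and>
      ((X (Suc n), Y (Suc n)), (X (Suc (Suc n)), Y (Suc (Suc n)))) \<in> up \<union> up\<inverse>"
    then have e: "X (Suc n) = X n" "X (Suc (Suc n)) = X n" "Y (Suc n) \<noteq> Y n" "Y (Suc n) \<noteq> Y (Suc (Suc n))"
      by (auto simp: up_def)
    then have "Y n = Y (Suc (Suc n))"
      using column_unique[of "X n" "Y (Suc n)" "Y n" "Y (Suc (Suc n))"]
        G[of n] G[of "Suc n"] G[of "Suc (Suc n)"] by simp
    moreover have "Y n \<le> Y (Suc n) \<and> Y (Suc n) \<le> Y (Suc (Suc n)) \<or> Y (Suc n) \<le> Y n \<and> Y (Suc (Suc n)) \<le> Y (Suc n)"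
      using Y by (auto simp: monoseq_Suc)
    ultimately show False using e by auto
  qed
  have H: "\<not> (((X n, Y n), (X (Suc n), Y (Suc n))) \<in> right \<union> right\<inverse> \<and>
      ((X (Suc n), Y (Suc n)), (X (Suc (Suc n)), Y (Suc (Suc n)))) \<in> right \<union> right\<inverse>)" for n
  proof
    assume *: "((X n, Y n), (X (Suc n), Y (Suc n))) \<in> right \<union> right\<inverse> \<and>
      ((X (Suc n), Y (Suc n)), (X (Suc (Suc n)), Y (Suc (Suc n)))) \<in> right \<union> right\<inverse>"
    then have e: "Y (Suc n) = Y n" "Y (Suc (Suc n)) = Y n" "X (Suc n) \<noteq> X n" "X (Suc n) \<noteq> X (Suc (Suc n))"
      by (auto simp: right_def)
    then have "X n = X (Suc (Suc n))"
      using row_unique[of "X (Suc n)" "Y n" "X n" "X (Suc (Suc n))"]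
        G[of n] G[of "Suc n"] G[of "Suc (Suc n)"] by simp
    moreover have "X n \<le> X (Suc n) \<and> X (Suc n) \<le> X (Suc (Suc n)) \<or> X (Suc n) \<le> X n \<and> X (Suc (Suc n)) \<le> X (Suc n)"
      using X by (auto simp: monoseq_Suc)
    ultimately show False using e by auto
  qed
  have "norm (X n) \<le> 1" "norm (Y n) \<le> 1" for n using unit[OF G[of n]] by auto
  then have "Bseq X" "Bseq Y" by (blast intro: BseqI')+
  then obtain a b where "X \<longlonglongrightarrow> a" "Y \<longlonglongrightarrow> b"
    using X Y Bseq_monoseq_convergent by (metis convergent_def)
  moreover have "\<exists>\<^sub>F n in sequentially. ((X n, Y n), (X (Suc n), Y (Suc n))) \<in> up \<union> up\<inverse>"
    unfolding frequently_sequentially using step H by (meson Un_iff le_Suc_eq order_refl)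
  moreover have "\<exists>\<^sub>F n in sequentially. ((X n, Y n), (X (Suc n), Y (Suc n))) \<in> right \<union> right\<inverse>"
    unfolding frequently_sequentially using step V by (meson Un_iff le_Suc_eq order_refl)
  ultimately show False using no_convergent_staircase G by blast
qed

section \<open>Well-foundedness in both directions and Koenig's lemma\<close>

lemma wf_down: "wf (up \<union> right)"
  unfolding wf_iff_no_infinite_down_chain
proof safe
  fix f assume *: "\<forall>i. (f (Suc i), f i) \<in> up \<union> right"
  have step: "fst (f (Suc n)) \<le> fst (f n) \<and> snd (f (Suc n)) \<le> snd (f n) \<and> f n \<in> G" for n
    using *[rule_format, of n] by (auto simp: up_def right_def split_beta)
  then have "decseq (fst \<circ> f)" "decseq (snd \<circ> f)"
    by (auto intro!: decseq_SucI)
  then show False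
    using no_monotone_staircase[of "fst \<circ> f" "snd \<circ> f"] * step by (auto simp: decseq_imp_monoseq)
qed

text \<open>Like a descending chain, an ascending one would be a monotone staircase.
  \<open>wf_down\<close> serves to bound the ancestors of a point, \<open>wf_up\<close> to reach a
  terminal point.\<close>

lemma wf_up: "wf ((up \<union> right)\<inverse>)"
  unfolding wf_iff_no_infinite_down_chain
proof safe
  fix f assume *: "\<forall>i. (f (Suc i), f i) \<in> (up \<union> right)\<inverse>"
  have step: "fst (f n) \<le> fst (f (Suc n)) \<and> snd (f n) \<le> snd (f (Suc n)) \<and> f n \<in> G" for n
    using *[rule_format, of n] by (auto simp: up_def right_def split_beta)
  then have "incseq (fst \<circ> f)" "incseq (snd \<circ> f)"
    by (auto intro!: incseq_SucI)
  then show False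
    using no_monotone_staircase[of "fst \<circ> f" "snd \<circ> f"] * step by (auto simp: incseq_imp_monoseq)
qed

text \<open>Vieta determines the partner below in the column and the partner to the left in the
  row.\<close>

lemma finite_predecessors: "finite {P. (P, R) \<in> up \<union> right}"
proof -
  obtain x y where R: "R = (x, y)" by fastforce
  have "{P. (P, R) \<in> up \<union> right}
      \<subseteq> {(x, quad (\<lambda>s. p s 1) x / (quad (\<lambda>s. p s (-1)) x * y)), (quad (\<lambda>t. p 1 t) y / (quad (\<lambda>t. p (-1) t) y * x), y)}"
    (is "_ \<subseteq> {?V, ?H}")
  proof
    fix P assume "P \<in> {P. (P, R) \<in> up \<union> right}"
    then consider y' where "P = (x, y')" "y' < y" "(x, y') \<in> G" "(x, y) \<in> G"
      | x' where "P = (x', y)" "x' < x" "(x', y) \<in> G" "(x, y) \<in> G"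
      by (auto simp: R up_def right_def)
    then show "P \<in> {?V, ?H}"
    proof cases
      case 1
      then show ?thesis
        using column_roots[of x y y'] a_y[of x] unit[of x y] by (simp add: field_simps)
    next
      case 2
      then show ?thesis
        using row_roots[of x y x'] a_x[of y] unit[of x y] by (simp add: field_simps)
    qed
  qed
  then show ?thesis by (rule finite_subset) simp
qed

text \<open>Koenig's lemma as an induction: finite branching along a well-founded relation.\<close>

lemma finite_ancestors: "finite {P. (P, R) \<in> (up \<union> right)\<^sup>*}"
proof (induction R rule: wf_induct[OF wf_down])
  case (1 R)
  have "{P. (P, R) \<in> (up \<union> right)\<^sup>*} =
      insert R (\<Union>S\<in>{S. (S, R) \<in> up \<union> right}. {P. (P, S) \<in> (up \<union> right)\<^sup>*})"
    by (auto elim: rtranclE intro: rtrancl_into_rtrancl)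
  then show ?case using 1 finite_predecessors by simp
qed

text \<open>A point with both defects nonzero has a partner in its column and one in its row, not
  both smaller by \<open>no_upper_right_corner\<close>. So one can move up or right until a defect
  vanishes.\<close>

lemma reaches_terminal:
  "P \<in> G \<Longrightarrow> \<exists>R\<in>{(x, y) \<in> G. bal p h x y = 0 \<or> bal (transp_p p) v y x = 0}. (P, R) \<in> (up \<union> right)\<^sup>*"
proof (induction P rule: wf_induct[OF wf_up])
  case (1 P)
  obtain x y where P: "P = (x, y)" by fastforce
  show ?case
  proof (cases "bal p h x y = 0 \<or> bal (transp_p p) v y x = 0")
    case True
    then show ?thesis using 1(2) P by blast
  next
    case False
    have xy: "(x, y) \<in> G" using 1(2) P by simp
    obtain y' where y': "(x, y') \<in> G" "bal p h x y * bal p h x y' < 0" using column[OF xy] False by blast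
    obtain x' where x': "(x', y) \<in> G" "bal (transp_p p) v y x * bal (transp_p p) v y x' < 0"
      using row[OF xy] False by blast
    have ne: "y' \<noteq> y" "x' \<noteq> x" using y' x' by (auto simp: mult_less_0_iff)
    have "\<not> (x' < x \<and> y' < y)"
      using no_upper_right_corner[where p = p, OF p_nonneg p_le_1 _ _ _ _ zero[OF xy] _ zero[OF x'(1)] _ zero[OF y'(1)]]
        unit[OF xy] a_x a_y by blast
    then consider "x < x'" | "y < y'" using ne by linarith
    then have "\<exists>S. (P, S) \<in> up \<union> right"
    proof cases
      case 1
      then have "(P, (x', y)) \<in> right" using x' xy by (simp add: right_def P)
      then show ?thesis by blast
    next
      case 2
      then have "(P, (x, y')) \<in> up" using y' xy by (simp add: up_def P)
      then show ?thesis by blast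
    qed
    then obtain S where S: "(P, S) \<in> up \<union> right" by blast
    then have "S \<in> G" by (auto simp: up_def right_def)
    then show ?thesis using 1(1) S by (meson converse_iff converse_rtrancl_into_rtrancl)
  qed
qed

lemma finite_if_finite_terminals:
  assumes "finite {(x, y) \<in> G. bal p h x y = 0 \<or> bal (transp_p p) v y x = 0}" (is "finite ?T")
  shows "finite G"
proof -
  have "G \<subseteq> (\<Union>R\<in>?T. {P. (P, R) \<in> (up \<union> right)\<^sup>*})" using reaches_terminal by blast
  then show ?thesis using assms finite_ancestors by (rule finite_subset[OF _ finite_UN_I])
qed

end

section \<open>Consequences of non-singularity and irreducibility\<close>

definition quad_poly :: "(int \<Rightarrow> real) \<Rightarrow> real poly" where
  "quad_poly c = [:c 1, c 0, c (-1):]"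

lemma poly_quad_poly: "poly (quad_poly c) x = quad c x"
  by (simp add: quad_poly_def quad_def algebra_simps power2_eq_square)

lemma quad_poly_eq_0_iff: "quad_poly c = 0 \<longleftrightarrow> c 1 = 0 \<and> c 0 = 0 \<and> c (-1) = 0"
  by (simp add: quad_poly_def)

lemma quad_pos:
  assumes "\<And>s. 0 \<le> c s" "quad_poly c \<noteq> 0" "0 < x"
  shows "0 < quad c x"
proof -
  have "0 \<le> c 1" "0 \<le> c 0 * x" "0 \<le> c (-1) * x^2" using assms by simp_all
  moreover have "0 < c 1 \<or> 0 < c 0 * x \<or> 0 < c (-1) * x^2"
    using assms by (auto simp: quad_poly_eq_0_iff less_le)
  ultimately show ?thesis unfolding quad_def by linarith
qed

lemma Q_poly_eq:
  "Q_poly K = [:quad_poly (\<lambda>s. p_int K s 1), quad_poly (\<lambda>s. p_int K s 0) - [:0, 1:],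
     quad_poly (\<lambda>s. p_int K s (-1)):]"
  by (simp add: Q_poly_def sum_pm1 quad_poly_def monom_Suc monom_0 numeral_2_eq_2 flip: add.assoc)

lemma eval2_Q_poly_kernel: "eval2 (Q_poly K) x y = kernel (p_int K) x y"
  by (simp add: Q_poly_eq eval2_simps kernel_def poly_quad_poly algebra_simps power2_eq_square)

lemma jump_nonneg: "0 \<le> jump K s t i j"
  by (simp add: jump_def)

lemma p_int_nonneg: "0 \<le> p_int K s t"
  by (simp add: p_int_def jump_nonneg)

lemma Q_poly_nonzero:
  assumes "\<not> singular_walk K"
  shows "Q_poly K \<noteq> 0"
  using assms by (auto simp: singular_walk_def)

text \<open>If the coefficient of the square of \<open>y\<close> vanished, so would that of
  \<open>y\<close>, degree 1 being singular. Then Q would be a polynomial in \<open>x\<close> with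
  nonnegative coefficients and a positive zero, hence zero and not irreducible.\<close>

lemma nonsingular_y:
  assumes ns: "\<not> singular_walk K" and xy: "0 < x" "0 < y" "kernel (p_int K) x y = 0"
  shows "quad_poly (\<lambda>s. p_int K s (-1)) \<noteq> 0"
proof
  assume 2: "quad_poly (\<lambda>s. p_int K s (-1)) = 0"
  have 1: "quad_poly (\<lambda>s. p_int K s 0) - [:0, 1:] = 0"
    using ns by (auto simp: singular_walk_def degree_y_def Q_poly_eq 2 split: if_splits)
  have "quad (\<lambda>s. p_int K s 1) x = 0"
    using xy(3) eval2_Q_poly_kernel[of K x y] by (simp add: Q_poly_eq 1 2 eval2_simps poly_quad_poly)
  then have "quad_poly (\<lambda>s. p_int K s 1) = 0"
    using quad_pos[of "\<lambda>s. p_int K s 1" x] xy(1)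
    by (auto simp: p_int_nonneg)
  then show False using Q_poly_nonzero[OF ns] by (simp add: Q_poly_eq 1 2)
qed

lemma nonsingular_x:
  assumes ns: "\<not> singular_walk K" and xy: "0 < x" "0 < y" "kernel (p_int K) x y = 0"
  shows "quad_poly (\<lambda>t. p_int K (-1) t) \<noteq> 0"
proof
  assume "quad_poly (\<lambda>t. p_int K (-1) t) = 0"
  then have m: "p_int K (-1) t = 0" if "t \<in> {-1, 0, 1}" for t
    using that by (auto simp: quad_poly_eq_0_iff)
  let ?Q = "Q_poly K" and ?D = "(\<lambda>k. degree (coeff (Q_poly K) k)) ` {..degree (Q_poly K)}"
  have le: "degree (coeff ?Q k) \<le> 1" for k
    by (auto simp: Q_poly_eq quad_poly_def m coeff_pCons split: nat.split)
  have "degree (coeff ?Q k) = 0" for k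
  proof (rule ccontr)
    assume "degree (coeff ?Q k) \<noteq> 0"
    then have d: "degree (coeff ?Q k) = 1" using le[of k] by simp
    then have "k \<le> degree ?Q" by (metis coeff_eq_0 degree_0 not_le zero_neq_one)
    then have "1 \<in> ?D" using d by (metis atMost_iff image_eqI)
    then have "Max ?D = 1" using le by (intro Max_eqI) auto
    then show False using ns by (simp add: singular_walk_def degree_x_def)
  qed
  \<comment> \<open>All coefficients are constant in \<open>x\<close>; the term -xy of Q forces
    \<open>p_int K 0 0 = 1\<close>.\<close>
  from this[of 0] this[of 1] this[of 2]
  have c: "p_int K 0 1 = 0" "p_int K 0 0 = 1" "p_int K 0 (-1) = 0"
    by (auto simp: Q_poly_eq quad_poly_def m numeral_2_eq_2 split: if_splits)
  have "quad (\<lambda>t. p_int K 1 t) y = 0"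
    using xy(3) by (simp add: kernel_def quad_def c m)
  then have "quad_poly (\<lambda>t. p_int K 1 t) = 0"
    using quad_pos[of "\<lambda>t. p_int K 1 t" y] xy(2) by (auto simp: p_int_nonneg)
  then show False
    using Q_poly_nonzero[OF ns] c m by (simp add: Q_poly_eq quad_poly_def)
qed

section \<open>Total mass of the steps and exit from the origin\<close>

lemma p_int_sum_le_1: "(\<Sum>s=-1..1. \<Sum>t=-1..1. p_int K s t) \<le> 1"
proof -
  \<comment> \<open>The nine steps from (1,1) lead to nine distinct states.\<close>
  have "(\<Sum>s=-1..1. \<Sum>t=-1..1. p_int K s t) = sum (pmf (K (1, 1))) ({0, 1, 2} \<times> {0, 1, 2})"
    by (simp add: sum_pm1 p_int_def jump_def sum.cartesian_product[symmetric] case_prod_eta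
        flip: sum.cartesian_product')
  also have "\<dots> = measure_pmf.prob (K (1, 1)) ({0, 1, 2} \<times> {0, 1, 2})"
    by (simp add: measure_measure_pmf_finite)
  also have "\<dots> \<le> 1" by simp
  finally show ?thesis .
qed

lemma trajectory_absorbing:
  assumes "set_pmf (K x) \<subseteq> {x}" "ys \<in> set_pmf (trajectory K n x)"
  shows "set ys \<subseteq> {x}"
  using assms(2)
proof (induction n arbitrary: ys)
  case (Suc n)
  then obtain y zs where "y \<in> set_pmf (K x)" "zs \<in> set_pmf (trajectory K n y)" "ys = y # zs" by auto
  then show ?case using assms(1) Suc.IH[of zs] by auto
qed simp

lemma irreducible_not_absorbing:
  assumes "irreducible_chain K" "x \<noteq> y"
  shows "\<not> set_pmf (K x) \<subseteq> {x}"
proof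
  assume a: "set_pmf (K x) \<subseteq> {x}"
  have "last (x # ys) \<noteq> y" if "ys \<in> set_pmf (trajectory K n x)" for ys n
    using trajectory_absorbing[OF a that] assms(2) last_in_set[of "x # ys"] by auto
  then have "nstep_prob K n x y = 0" for n
    unfolding nstep_prob_def measure_pmf_zero_iff by blast
  then show False using assms(1) unfolding irreducible_chain_def by (metis less_irrefl)
qed

text \<open>Homogeneity with shifted indices compares transitions by their targets, so those leaving
  the origin agree with \<open>p_int\<close>, \<open>p_hor\<close> and \<open>p_ver\<close>. If all
  three vanished, the origin would be absorbing.\<close>

lemma origin_exit:
  assumes h: "homogeneous_walk K" and irr: "irreducible_chain K"
  shows "p_int K 1 1 \<noteq> 0 \<or> p_hor K 1 \<noteq> 0 \<or> p_ver K 1 \<noteq> 0"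
proof (rule ccontr)
  assume z: "\<not> ?thesis"
  have hom: "jump K s t (i - s) (j - t) = jump K s t (k - s) (l - t)"
    if "A \<in> {interior_states, horizontal_axis, vertical_axis}" "(i, j) \<in> A" "(k, l) \<in> A"
      "s \<in> {-1, 0, 1}" "t \<in> {-1, 0, 1}" for A s t i j k l
  proof -
    note H = h[unfolded homogeneous_walk_def, THEN conjunct2, THEN bspec, OF that(1),
        THEN bspec, OF that(2), unfolded prod.case, THEN bspec, OF that(3), unfolded prod.case,
        THEN bspec, OF that(4), THEN bspec, OF that(5)]
    show ?thesis by (rule conjunct2[OF H])
  qed
  have "jump K 1 1 (1 - 1) (1 - 1) = jump K 1 1 (2 - 1) (2 - 1)"
    by (rule hom[of interior_states]) (auto simp: interior_states_def)
  then have 1: "jump K 1 1 0 0 = 0" using z by (simp add: p_int_def)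
  have "jump K 1 0 (1 - 1) (0 - 0) = jump K 1 0 (2 - 1) (0 - 0)"
    by (rule hom[of horizontal_axis]) (auto simp: horizontal_axis_def)
  then have 2: "jump K 1 0 0 0 = 0" using z by (simp add: p_hor_def)
  have "jump K 0 1 (0 - 0) (1 - 1) = jump K 0 1 (0 - 0) (2 - 1)"
    by (rule hom[of vertical_axis]) (auto simp: vertical_axis_def)
  then have 3: "jump K 0 1 0 0 = 0" using z by (simp add: p_ver_def)
  have "set_pmf (K (0, 0)) \<subseteq> {(0, 0)}"
  proof
    fix z assume "z \<in> set_pmf (K (0, 0))"
    moreover obtain i j where z: "z = (i, j)" by fastforce
    ultimately have j: "jump K (int i) (int j) 0 0 \<noteq> 0" by (simp add: jump_def set_pmf_iff)
    then have "\<not> (\<bar>int i\<bar> > 1 \<or> \<bar>int j\<bar> > 1)" 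
      using h[unfolded homogeneous_walk_def, THEN conjunct1] by blast
    then have "i = 0 \<or> i = 1" "j = 0 \<or> j = 1" by auto
    then show "z \<in> {(0, 0)}" using j 1 2 3 z by auto
  qed
  then show False using irreducible_not_absorbing[OF irr, of "(0, 0)" "(1, 0)"] by simp
qed

text \<open>Each defect is linear in one variable, with the same leading coefficient as Q in that
  variable, so elimination applies. On \<open>G\<close> these leading coefficients are
  positive.\<close>

lemma finite_terminals:
  assumes ns: "\<not> singular_walk K"
    and G: "\<And>x y. (x, y) \<in> G \<Longrightarrow> 0 < x \<and> 0 < y \<and> kernel (p_int K) x y = 0"
  shows "finite {(x, y) \<in> G. bal (p_int K) h x y = 0 \<or> bal (transp_p (p_int K)) v y x = 0}"
proof (cases "G = {}")
  case True
  then show ?thesis by simp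
next
  case False
  then obtain x0 y0 where "(x0, y0) \<in> G" by fastforce
  note 0 = G[OF this]
  let ?p = "p_int K"
  have q2: "quad_poly (\<lambda>s. ?p s (-1)) \<noteq> 0" using nonsingular_y[OF ns] 0 by blast
  have r2: "quad_poly (\<lambda>t. ?p (-1) t) \<noteq> 0" using nonsingular_x[OF ns] 0 by blast
  have prime: "prime_elem (Q_poly K)"
    using ns by (intro irreducible_imp_prime_elem) (simp add: singular_walk_def)
  have pos: "0 < quad (\<lambda>s. ?p s (-1)) x" if "0 < x" for x
    using quad_pos[OF _ q2 that] p_int_nonneg by blast
  have pos': "0 < quad (\<lambda>t. ?p (-1) t) y" if "0 < y" for y
    using quad_pos[OF _ r2 that] p_int_nonneg by blast
  have 1: "finite {(x, y). eval2 (Q_poly K) x y = 0 \<and>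
      poly (quad_poly h - [:0, 1:]) x + poly (quad_poly (\<lambda>s. ?p s (-1))) x * y = 0 \<and>
      poly (quad_poly (\<lambda>s. ?p s (-1))) x \<noteq> 0}" (is "finite ?A")
    unfolding Q_poly_eq by (rule finite_common_zeros_y[OF prime[unfolded Q_poly_eq] q2])
  have 2: "finite {(x, y). eval2 (Q_poly K) x y = 0 \<and>
      poly (quad_poly v - [:0, 1:]) y + poly (quad_poly (\<lambda>t. ?p (-1) t)) y * x = 0 \<and>
      poly (quad_poly (\<lambda>t. ?p (-1) t)) y \<noteq> 0}" (is "finite ?B")
  proof (rule finite_common_zeros_x[OF prime])
    show "eval2 (Q_poly K) x y = poly (quad_poly (\<lambda>t. ?p 1 t)) y +
        poly (quad_poly (\<lambda>t. ?p 0 t) - [:0, 1:]) y * x + poly (quad_poly (\<lambda>t. ?p (-1) t)) y * x^2" for x y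
      by (simp add: eval2_Q_poly_kernel poly_quad_poly kernel_def quad_def algebra_simps power2_eq_square)
    show "poly (quad_poly (\<lambda>t. ?p (-1) t)) 1 \<noteq> 0" using pos'[of 1] by (simp add: poly_quad_poly)
  qed
  have "{(x, y) \<in> G. bal ?p h x y = 0 \<or> bal (transp_p ?p) v y x = 0} \<subseteq> ?A \<union> ?B"
  proof
    fix z assume "z \<in> {(x, y) \<in> G. bal ?p h x y = 0 \<or> bal (transp_p ?p) v y x = 0}"
    then obtain x y where z: "z = (x, y)" and xy: "(x, y) \<in> G"
      and b: "bal ?p h x y = 0 \<or> bal (transp_p ?p) v y x = 0" by blast
    have e: "eval2 (Q_poly K) x y = 0" "poly (quad_poly (\<lambda>s. ?p s (-1))) x \<noteq> 0"
      "poly (quad_poly (\<lambda>t. ?p (-1) t)) y \<noteq> 0"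
      using G[OF xy] pos[of x] pos'[of y] by (simp_all add: eval2_Q_poly_kernel poly_quad_poly)
    show "z \<in> ?A \<union> ?B"
      using b
    proof
      assume "bal ?p h x y = 0"
      then have "poly (quad_poly h - [:0, 1:]) x + poly (quad_poly (\<lambda>s. ?p s (-1))) x * y = 0"
        by (simp add: bal_def poly_quad_poly)
      then have "z \<in> ?A" using e z by blast
      then show ?thesis ..
    next
      assume "bal (transp_p ?p) v y x = 0"
      then have "poly (quad_poly v - [:0, 1:]) y + poly (quad_poly (\<lambda>t. ?p (-1) t)) y * x = 0"
        by (simp add: bal_def poly_quad_poly)
      then have "z \<in> ?B" using e z by blast
      then show ?thesis ..
    qed
  qed
  then show ?thesis using 1 2 by (meson finite_UnI finite_subset)
qed

section \<open>Boundary balance equations as vanishing moments\<close>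

lemma horizontal_balance:
  assumes inv: "invariant_measure K m"
    and S: "\<And>i j. ((\<lambda>z. \<alpha> z * fst z ^ i * snd z ^ j) has_sum m (i, j)) G"
  shows "((\<lambda>z. \<alpha> z * bal (p_int K) (p_hor K) (fst z) (snd z) * fst z ^ n) has_sum 0) G"
proof -
  let ?p = "p_int K" and ?h = "p_hor K"
  have "\<forall>i>0. m (nat i, 0) = (\<Sum>s = -1..1. m (nat (i - s), 1) * ?p s (-1)) + (\<Sum>s = -1..1. m (nat (i - s), 0) * ?h s)"
    using inv unfolding invariant_measure_def by blast
  \<comment> \<open>Balance at the state (n + 1, 0): the smallest power of \<rho> that occurs is
    then the n-th, which factors out of every term and leaves \<open>bal\<close>.\<close>
  from this[rule_format, of "int (Suc n)"]
  have "m (Suc n, 0) = m (n + 2, 1) * ?p (-1) (-1) + m (n + 1, 1) * ?p 0 (-1) + m (n, 1) * ?p 1 (-1)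
      + (m (n + 2, 0) * ?h (-1) + m (n + 1, 0) * ?h 0 + m (n, 0) * ?h 1)"
    by (simp add: sum_pm1 nat_add_distrib)
  then have z: "?p (-1) (-1) * m (n + 2, 1) + ?p 0 (-1) * m (n + 1, 1) + ?p 1 (-1) * m (n, 1)
      + (?h (-1) * m (n + 2, 0) + ?h 0 * m (n + 1, 0) + ?h 1 * m (n, 0)) + (-1) * m (n + 1, 0) = 0"
    by (simp add: mult.commute)
  let ?f = "\<lambda>i j z. \<alpha> z * fst z ^ i * snd z ^ j"
  have "((\<lambda>z. ?p (-1) (-1) * ?f (n + 2) 1 z + ?p 0 (-1) * ?f (n + 1) 1 z + ?p 1 (-1) * ?f n 1 z
      + (?h (-1) * ?f (n + 2) 0 z + ?h 0 * ?f (n + 1) 0 z + ?h 1 * ?f n 0 z) + (-1) * ?f (n + 1) 0 z) has_sum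
      ?p (-1) (-1) * m (n + 2, 1) + ?p 0 (-1) * m (n + 1, 1) + ?p 1 (-1) * m (n, 1)
      + (?h (-1) * m (n + 2, 0) + ?h 0 * m (n + 1, 0) + ?h 1 * m (n, 0)) + (-1) * m (n + 1, 0)) G"
    by (intro has_sum_add has_sum_cmult_right S)
  then show ?thesis
    unfolding z
    by (rule has_sum_cong[THEN iffD1, rotated])
      (simp add: bal_def quad_def algebra_simps power2_eq_square)
qed

lemma vertical_balance:
  assumes inv: "invariant_measure K m"
    and S: "\<And>i j. ((\<lambda>z. \<alpha> z * fst z ^ i * snd z ^ j) has_sum m (i, j)) G"
  shows "((\<lambda>z. \<alpha> z * bal (transp_p (p_int K)) (p_ver K) (snd z) (fst z) * snd z ^ n) has_sum 0) G"
proof -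
  let ?p = "p_int K" and ?v = "p_ver K"
  have "\<forall>j>0. m (0, nat j) = (\<Sum>t = -1..1. m (1, nat (j - t)) * ?p (-1) t) + (\<Sum>t = -1..1. m (0, nat (j - t)) * ?v t)"
    using inv unfolding invariant_measure_def by blast
  from this[rule_format, of "int (Suc n)"]
  have "m (0, Suc n) = m (1, n + 2) * ?p (-1) (-1) + m (1, n + 1) * ?p (-1) 0 + m (1, n) * ?p (-1) 1
      + (m (0, n + 2) * ?v (-1) + m (0, n + 1) * ?v 0 + m (0, n) * ?v 1)"
    by (simp add: sum_pm1 nat_add_distrib)
  then have z: "?p (-1) (-1) * m (1, n + 2) + ?p (-1) 0 * m (1, n + 1) + ?p (-1) 1 * m (1, n)
      + (?v (-1) * m (0, n + 2) + ?v 0 * m (0, n + 1) + ?v 1 * m (0, n)) + (-1) * m (0, n + 1) = 0"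
    by (simp add: mult.commute)
  let ?f = "\<lambda>i j z. \<alpha> z * fst z ^ i * snd z ^ j"
  have "((\<lambda>z. ?p (-1) (-1) * ?f 1 (n + 2) z + ?p (-1) 0 * ?f 1 (n + 1) z + ?p (-1) 1 * ?f 1 n z
      + (?v (-1) * ?f 0 (n + 2) z + ?v 0 * ?f 0 (n + 1) z + ?v 1 * ?f 0 n z) + (-1) * ?f 0 (n + 1) z) has_sum
      ?p (-1) (-1) * m (1, n + 2) + ?p (-1) 0 * m (1, n + 1) + ?p (-1) 1 * m (1, n)
      + (?v (-1) * m (0, n + 2) + ?v 0 * m (0, n + 1) + ?v 1 * m (0, n)) + (-1) * m (0, n + 1)) G"
    by (intro has_sum_add has_sum_cmult_right S)
  then show ?thesis
    unfolding z
    by (rule has_sum_cong[THEN iffD1, rotated])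
      (simp add: bal_def quad_def algebra_simps power2_eq_square)
qed

section \<open>Contradiction from positive coefficients\<close>

theorem theorem21:
  fixes K :: "nat \<times> nat \<Rightarrow> (nat \<times> nat) pmf"
    and m :: "nat \<times> nat \<Rightarrow> real"
    and \<Gamma> :: "(real \<times> real) set"
    and \<alpha> :: "real \<times> real \<Rightarrow> real"
  assumes "homogeneous_walk K"
    and "\<not> singular_walk K"
    and "irreducible_chain K"
    and "aperiodic_chain K"
    and "positive_recurrent_chain K"
    and "invariant_measure K m"
    and "\<Gamma> \<subseteq> Q_plus_U K"
    and "infinite \<Gamma>"
    and "\<forall>(\<rho>, \<sigma>) \<in> \<Gamma>. \<alpha> (\<rho>, \<sigma>) \<noteq> 0"
    and "(\<lambda>(\<rho>, \<sigma>). \<bar>\<alpha> (\<rho>, \<sigma>)\<bar> * (1 / (1 - \<rho>)) * (1 / (1 - \<sigma>))) summable_on \<Gamma>"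
    and "\<forall>(\<rho>, \<sigma>) \<in> \<Gamma>. \<exists>w>0. \<exists>v>0. \<forall>(\<rho>', \<sigma>') \<in> \<Gamma> - {(\<rho>, \<sigma>)}.
           \<rho>' ^ w * \<sigma>' ^ v \<noteq> \<rho> ^ w * \<sigma> ^ v"
    and "\<forall>i j. ((\<lambda>(\<rho>, \<sigma>). \<alpha> (\<rho>, \<sigma>) * \<rho> ^ i * \<sigma> ^ j) has_sum m (i, j)) \<Gamma>"
  shows "\<exists>(\<rho>, \<sigma>) \<in> \<Gamma>. \<alpha> (\<rho>, \<sigma>) < 0"
proof (rule ccontr)
  assume "\<not> ?thesis"
  then have \<alpha>: "0 < \<alpha> z" if "z \<in> \<Gamma>" for z
    using assms(9) that by (cases z) (force simp: not_less le_less)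
  have S: "((\<lambda>z. \<alpha> z * fst z ^ i * snd z ^ j) has_sum m (i, j)) \<Gamma>" for i j
    using assms(12)[rule_format, of i j] by (simp add: case_prod_unfold)
  have \<Gamma>: "0 < x \<and> x < 1 \<and> 0 < y \<and> y < 1 \<and> kernel (p_int K) x y = 0" if "(x, y) \<in> \<Gamma>" for x y
    using that assms(7) by (auto simp: Q_plus_U_def Q_plus_def Q_curve_def eval2_Q_poly_kernel)
  \<comment> \<open>A zero of Q with positive coordinates, as \<open>nonsingular_y\<close> and
    \<open>nonsingular_x\<close> require.\<close>
  obtain x0 y0 where "(x0, y0) \<in> \<Gamma>" using assms(8) by (metis ex_in_conv finite.emptyI surj_pair)
  note 0 = \<Gamma>[OF this]
  interpret balanced_points "p_int K" "p_hor K" "p_ver K" \<Gamma>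
  proof
    show "0 \<le> p_int K s t" for s t by (rule p_int_nonneg)
    show "(\<Sum>s=-1..1. \<Sum>t=-1..1. p_int K s t) \<le> 1" by (rule p_int_sum_le_1)
    show "0 < quad (\<lambda>s. p_int K s (-1)) x" if "0 < x" for x
      using nonsingular_y[OF assms(2)] 0 that by (intro quad_pos p_int_nonneg) blast+
    show "0 < quad (\<lambda>t. p_int K (-1) t) y" if "0 < y" for y
      using nonsingular_x[OF assms(2)] 0 that by (intro quad_pos p_int_nonneg) blast+
    show "p_int K 1 1 \<noteq> 0 \<or> p_hor K 1 \<noteq> 0 \<or> p_ver K 1 \<noteq> 0"
      by (rule origin_exit[OF assms(1,3)])
    show "0 < x \<and> x < 1 \<and> 0 < y \<and> y < 1" "kernel (p_int K) x y = 0" if "(x, y) \<in> \<Gamma>" for x y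
      using \<Gamma>[OF that] by blast+
    show "\<exists>y'. (x, y') \<in> \<Gamma> \<and> bal (p_int K) (p_hor K) x y * bal (p_int K) (p_hor K) x y' < 0"
      if xy: "(x, y) \<in> \<Gamma>" and ne: "bal (p_int K) (p_hor K) x y \<noteq> 0" for x y
    proof -
      \<comment> \<open>The horizontal defects weighted by \<alpha> cancel on the column of
        \<open>x\<close>; as \<alpha> is positive, a defect of the opposite sign lies on it.\<close>
      have "((\<lambda>z. \<alpha> z * bal (p_int K) (p_hor K) (fst z) (snd z)) has_sum 0) {z \<in> \<Gamma>. fst z = x}"
        using \<Gamma> by (intro has_sum_fibre_zero_of_moments_zero horizontal_balance[OF assms(6) S]) (auto intro: less_imp_le)
      from has_sum_zero_opposite_sign[OF this, of "(x, y)"] show ?thesis using \<alpha> xy ne by auto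
    qed
    show "\<exists>x'. (x', y) \<in> \<Gamma> \<and>
        bal (transp_p (p_int K)) (p_ver K) y x * bal (transp_p (p_int K)) (p_ver K) y x' < 0"
      if xy: "(x, y) \<in> \<Gamma>" and ne: "bal (transp_p (p_int K)) (p_ver K) y x \<noteq> 0" for x y
    proof -
      have "((\<lambda>z. \<alpha> z * bal (transp_p (p_int K)) (p_ver K) (snd z) (fst z)) has_sum 0) {z \<in> \<Gamma>. snd z = y}"
        using \<Gamma> by (intro has_sum_fibre_zero_of_moments_zero vertical_balance[OF assms(6) S]) (auto intro: less_imp_le)
      from has_sum_zero_opposite_sign[OF this, of "(x, y)"] show ?thesis using \<alpha> xy ne by auto
    qed
  qed
  have "finite \<Gamma>"
    using \<Gamma> by (intro finite_if_finite_terminals finite_terminals[OF assms(2)]) blast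
  then show False using assms(8) by simp
qed

end
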